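(* Let $G(V, E)$ be a graph with $|V| = n$. Then $\mathrm{edim}(G) = n - 1 $ if and only if for any distinct $ v_1, v_2 \in V $ there exists $ u \in V $ such that $v_1u \in E, v_2u \in E$ and $u$ is adjacent to all non-mutual neighbors of $v_1, v_2$.
   Context: All graphs are simple, connected and undirected. For an edge $e=xy$ and a vertex $v$, $d(e,v)=\min\{d(x,v),d(y,v)\}$. A set $S\subseteq V$ is an edge metric generator if for any two distinct edges $e_1,e_2$ some $s\in S$ has $d(e_1,s)\neq d(e_2,s)$; $\mathrm{edim}(G)$ is the minimum size of an edge metric generator. $N(v)$ denotes the set of vertices adjacent to $v$ (not including $v$). The non-mutual neighbors of $v_1$ and $v_2$ are the vertices of $(N(v_1)\cup N(v_2))\setminus(N(v_1)\cap N(v_2))$. *)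

theory Defs
  imports "Graph_Theory.Digraph_Component" "Graph_Theory.Shortest_Path"
begin

text \<open>
  A finite simple undirected graph is represented by the locale \<^locale>\<open>graph\<close>: a finite
  symmetric digraph without loops and parallel arcs. An undirected edge \<open>xy\<close> corresponds to the
  two arcs from \<open>x\<close> to \<open>y\<close> and from \<open>y\<close> to \<open>x\<close>; both have the same set \<open>{x, y}\<close> of ends.
\<close>

definition edges :: "('a, 'b) pre_digraph \<Rightarrow> 'a set set" where
  "edges G = (\<lambda>a. {tail G a, head G a}) ` arcs G"

definition vertex_dist :: "('a, 'b) pre_digraph \<Rightarrow> 'a \<Rightarrow> 'a \<Rightarrow> ereal" where
  "vertex_dist G u v = wf_digraph.\<mu> G (\<lambda>_. 1) u v"
  \<comment> \<open>unit arc costs: the least number of arcs on a walk from \<open>u\<close> to \<open>v\<close>\<close>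

definition edge_dist :: "('a, 'b) pre_digraph \<Rightarrow> 'a set \<Rightarrow> 'a \<Rightarrow> ereal" where
  "edge_dist G e v = Min ((\<lambda>x. vertex_dist G x v) ` e)"

definition edge_metric_generator :: "('a, 'b) pre_digraph \<Rightarrow> 'a set \<Rightarrow> bool" where
  "edge_metric_generator G S \<longleftrightarrow> S \<subseteq> verts G \<and>
     (\<forall>e1 \<in> edges G. \<forall>e2 \<in> edges G. e1 \<noteq> e2 \<longrightarrow>
        (\<exists>s \<in> S. edge_dist G e1 s \<noteq> edge_dist G e2 s))"

text \<open>
  The minimum exists for a finite connected graph, since then \<^term>\<open>verts G\<close> is an edge metric
  generator. The empty set is a generator if the graph has at most one edge.
\<close>

definition edim :: "('a, 'b) pre_digraph \<Rightarrow> nat" where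
  "edim G = (LEAST k. \<exists>S. edge_metric_generator G S \<and> card S = k)"

definition neighbors :: "('a, 'b) pre_digraph \<Rightarrow> 'a \<Rightarrow> 'a set" where
  "neighbors G v = {u \<in> verts G. {v, u} \<in> edges G}"

definition non_mutual_neighbors :: "('a, 'b) pre_digraph \<Rightarrow> 'a \<Rightarrow> 'a \<Rightarrow> 'a set" where
  "non_mutual_neighbors G v1 v2 =
     (neighbors G v1 \<union> neighbors G v2) - (neighbors G v1 \<inter> neighbors G v2)"

end

theory Submission
  imports Defs
begin

text \<open>
  The complement of a single vertex is always a generator, and any generator with fewer than
  \<open>n - 1\<close> elements lies in the complement of two vertices \<open>v1\<close>, \<open>v2\<close>. Edges that this complement
  fails to distinguish differ only in \<open>v1\<close> and \<open>v2\<close>, so they are \<open>v1u\<close> and \<open>v2u\<close> for a common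
  neighbor \<open>u\<close>. They have the same distances to all other vertices iff \<open>u\<close> is adjacent to the
  non-mutual neighbors: for one direction look at the vertices at distance 1 from \<open>v1\<close> or \<open>v2\<close>,
  for the other at the first step of a shortest walk from \<open>v1\<close> that is shorter than those from
  \<open>v2\<close> and \<open>u\<close>.
\<close>

section \<open>Undirected edges and their ends\<close>

lemma edges_iff: "{u, v} \<in> edges G \<longleftrightarrow> (u, v) \<in> arcs_ends G \<or> (v, u) \<in> arcs_ends G"
proof -
  have "{u, v} \<in> edges G \<longleftrightarrow>
      (\<exists>a\<in>arcs G. tail G a = u \<and> head G a = v \<or> tail G a = v \<and> head G a = u)"
    unfolding edges_def image_iff doubleton_eq_iff by metis
  then show ?thesis
    unfolding arcs_ends_conv image_iff prod.inject by metis
qed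

context graph
begin

lemma edges_iff_dominates: "{u, v} \<in> edges G \<longleftrightarrow> u \<rightarrow>\<^bsub>G\<^esub> v"
  using arcs_ends_symmetric[OF sym_arcs] unfolding edges_iff by blast

lemma edgeE:
  assumes "e \<in> edges G"
  obtains x y where "e = {x, y}" "x \<noteq> y" "x \<in> verts G" "y \<in> verts G"
proof -
  obtain a where "a \<in> arcs G" "e = {tail G a, head G a}"
    using assms by (auto simp: edges_def)
  then show thesis
    using that[of "tail G a" "head G a"] no_loops by simp
qed

lemma edge_subset_verts: "e \<in> edges G \<Longrightarrow> e \<subseteq> verts G"
  by (auto simp: edges_def)

lemma edge_incidentE:
  assumes "e \<in> edges G" "v \<in> e"
  obtains u where "e = {v, u}" "u \<noteq> v" "u \<in> verts G"
proof -
  obtain x y where "e = {x, y}" "x \<noteq> y" "x \<in> verts G" "y \<in> verts G"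
    using assms(1) by (rule edgeE)
  then show thesis
    using that[of x] that[of y] assms(2) by (cases "v = x") (simp_all add: insert_commute)
qed

lemma edge_distinct: "{u, v} \<in> edges G \<Longrightarrow> u \<noteq> v"
  using adj_not_same by (auto simp: edges_iff)

lemma edge_in_verts:
  assumes "{u, v} \<in> edges G"
  shows "u \<in> verts G" "v \<in> verts G"
  using assms adj_in_verts by (auto simp: edges_iff_dominates)

section \<open>Distances between vertices as lengths of shortest walks\<close>

lemma awalk_cost_unit: "awalk_cost (\<lambda>_. 1) p = real (length p)"
  by (induct p) auto

lemma vertex_dist_le_length: "awalk u p v \<Longrightarrow> vertex_dist G u v \<le> ereal (real (length p))"
  using min_cost_le_walk_cost[of u p v "\<lambda>_. 1"] by (simp add: vertex_dist_def awalk_cost_unit)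

lemma shortest_awalk:
  assumes "vertex_dist G u v < \<infinity>"
  obtains p where "awalk u p v" "vertex_dist G u v = ereal (real (length p))"
proof -
  have "u \<rightarrow>\<^sup>* v"
    using assms unfolding vertex_dist_def \<mu>_reach_conv .
  then obtain p where "apath u p v" "\<mu> (\<lambda>_. 1) u v = awalk_cost (\<lambda>_. 1) p"
    using min_cost_awalk[of u v "\<lambda>_. 1"] by auto
  then show thesis
    using that by (auto simp: vertex_dist_def awalk_cost_unit apath_def)
qed

lemma vertex_dist_ge_one:
  assumes "u \<noteq> v"
  shows "1 \<le> vertex_dist G u v"
proof (cases "vertex_dist G u v < \<infinity>")
  case True
  then obtain p where p: "awalk u p v" "vertex_dist G u v = ereal (real (length p))"
    by (rule shortest_awalk)
  then have "p \<noteq> []"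
    using assms by (auto simp: awalk_Nil_iff)
  then show ?thesis
    using p(2) by (cases p) (auto simp: one_ereal_def)
qed simp

lemma vertex_dist_nonneg: "0 \<le> vertex_dist G u v"
proof (cases "vertex_dist G u v < \<infinity>")
  case True
  then show ?thesis
    by (rule shortest_awalk) auto
qed simp

lemma vertex_dist_self: "v \<in> verts G \<Longrightarrow> vertex_dist G v v = 0"
  using vertex_dist_le_length[of v "[]" v] vertex_dist_nonneg[of v v]
  by (simp add: awalk_Nil_iff flip: zero_ereal_def)

lemma vertex_dist_step:
  assumes "{u, w} \<in> edges G"
  shows "vertex_dist G u v \<le> 1 + vertex_dist G w v"
proof (cases "vertex_dist G w v < \<infinity>")
  case True
  then obtain p where p: "awalk w p v" "vertex_dist G w v = ereal (real (length p))"
    by (rule shortest_awalk)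
  obtain a where "a \<in> arcs G" "tail G a = u" "head G a = w"
    using assms by (auto simp: edges_iff_dominates)
  then have "awalk u (a # p) v"
    using p(1) by (auto simp: awalk_Cons_iff)
  from vertex_dist_le_length[OF this] show ?thesis
    using p(2) by (simp add: one_ereal_def)
qed simp

text \<open>Let \<open>w\<close> be the second vertex of a shortest walk. The rest of the walk
  bounds the distance from \<open>w\<close> above, and \<open>vertex_dist_step\<close> gives the
  reverse inequality.\<close>

lemma vertex_dist_first_step:
  assumes "u \<noteq> v" "vertex_dist G u v < \<infinity>"
  obtains w where "{u, w} \<in> edges G" "vertex_dist G u v = 1 + vertex_dist G w v"
proof -
  obtain p where p: "awalk u p v" "vertex_dist G u v = ereal (real (length p))"
    using assms(2) by (rule shortest_awalk)
  then obtain a q where pq: "p = a # q"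
    using assms(1) by (cases p) (auto simp: awalk_Nil_iff)
  then have a: "a \<in> arcs G" "tail G a = u" and q: "awalk (head G a) q v"
    using p(1) by (auto simp: awalk_Cons_iff)
  then have e: "{u, head G a} \<in> edges G"
    by (auto simp: edges_def)
  have "1 + vertex_dist G (head G a) v \<le> 1 + ereal (real (length q))"
    by (intro add_left_mono vertex_dist_le_length q)
  also have "\<dots> = vertex_dist G u v"
    using p(2) pq by (simp add: one_ereal_def)
  finally show thesis
    using that[OF e] vertex_dist_step[OF e, of v] by simp
qed

lemma vertex_dist_le_one_iff:
  assumes "u \<noteq> v"
  shows "vertex_dist G u v \<le> 1 \<longleftrightarrow> {u, v} \<in> edges G"
proof
  assume le: "vertex_dist G u v \<le> 1"
  then have "vertex_dist G u v < \<infinity>"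
    using le_less_trans[of "vertex_dist G u v" 1 \<infinity>] by simp
  then obtain w where w: "{u, w} \<in> edges G" "vertex_dist G u v = 1 + vertex_dist G w v"
    using vertex_dist_first_step[OF assms] by blast
  have "w = v"
  proof (rule ccontr)
    assume "w \<noteq> v"
    then have "1 \<le> vertex_dist G w v"
      by (rule vertex_dist_ge_one)
    with w(2) le show False
      by (cases "vertex_dist G w v") (auto simp: one_ereal_def)
  qed
  then show "{u, v} \<in> edges G"
    using w(1) by simp
next
  assume "{u, v} \<in> edges G"
  then show "vertex_dist G u v \<le> 1"
    using vertex_dist_step[of u v v] vertex_dist_self[of v] edge_in_verts by auto
qed

section \<open>Distances from edges to vertices\<close>

lemma edge_dist_pair: "edge_dist G {x, y} v = min (vertex_dist G x v) (vertex_dist G y v)"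
  by (cases "x = y") (simp_all add: edge_dist_def)

text \<open>Distinct vertices are at distance at least 1, so the minimum over the two ends vanishes
  only at an end. Thus a vertex in exactly one of two edges distinguishes them.\<close>

lemma edge_dist_eq_0_iff:
  assumes "e \<in> edges G" "v \<in> verts G"
  shows "edge_dist G e v = 0 \<longleftrightarrow> v \<in> e"
proof -
  obtain x y where e: "e = {x, y}"
    using assms(1) by (rule edgeE)
  have "vertex_dist G z v = 0 \<longleftrightarrow> z = v" for z
    using vertex_dist_self[OF assms(2)] vertex_dist_ge_one[of z v] by (cases "z = v") auto
  moreover have "min a b = 0 \<longleftrightarrow> a = 0 \<or> b = 0" if "0 \<le> a" "0 \<le> b" for a b :: ereal
    using that by (metis antisym min.absorb2 min.absorb1 min_def)
  ultimately show ?thesis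
    unfolding e edge_dist_pair using vertex_dist_nonneg by (metis insert_iff singletonD)
qed

text \<open>Every edge has exactly two ends. Consequently, of two distinct edges, each has an end
  outside the other.\<close>

lemma edges_eqI:
  assumes "e1 \<in> edges G" "e2 \<in> edges G" "e1 \<subseteq> e2"
  shows "e1 = e2"
proof -
  have "card e = 2" if "e \<in> edges G" for e
    using that by (rule edgeE) simp
  then have "card e1 = 2" "card e2 = 2"
    using assms(1,2) by blast+
  then show ?thesis
    using assms(3) by (metis card_subset_eq card.infinite zero_neq_numeral)
qed

text \<open>Distinct edges have private ends \<open>x\<close> and \<open>y\<close>, each of which
  distinguishes them. As \<open>x\<close> and \<open>y\<close> differ, at least one survives the
  removal of \<open>v\<close>.\<close>

lemma edge_metric_generator_remove1:
  assumes "v \<in> verts G"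
  shows "edge_metric_generator G (verts G - {v})"
  unfolding edge_metric_generator_def
proof (intro conjI ballI impI)
  fix e1 e2 assume e: "e1 \<in> edges G" "e2 \<in> edges G" "e1 \<noteq> e2"
  then obtain x y where xy: "x \<in> e1" "x \<notin> e2" "y \<in> e2" "y \<notin> e1"
    using edges_eqI[of e1 e2] edges_eqI[of e2 e1] by blast
  moreover have "x \<in> verts G" "y \<in> verts G"
    using e xy edge_subset_verts by blast+
  ultimately have "edge_dist G e1 x \<noteq> edge_dist G e2 x" "edge_dist G e1 y \<noteq> edge_dist G e2 y"
    using edge_dist_eq_0_iff[OF e(1)] edge_dist_eq_0_iff[OF e(2)] by metis+
  moreover have "x \<noteq> v \<or> y \<noteq> v"
    using xy by blast
  ultimately show "\<exists>s\<in>verts G - {v}. edge_dist G e1 s \<noteq> edge_dist G e2 s"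
    using \<open>x \<in> verts G\<close> \<open>y \<in> verts G\<close> by blast
qed blast

section \<open>Generators that omit two vertices\<close>

lemma edge_metric_generator_mono:
  "edge_metric_generator G S \<Longrightarrow> S \<subseteq> T \<Longrightarrow> T \<subseteq> verts G \<Longrightarrow> edge_metric_generator G T"
  unfolding edge_metric_generator_def by blast

text \<open>Let \<open>w\<close> be the first vertex after \<open>v1\<close> on a shortest walk to
  \<open>s\<close>. Either \<open>v2\<close> is adjacent to \<open>w\<close>, or \<open>u\<close> is
  by domination, so one of them is as close to \<open>s\<close> as \<open>v1\<close>.\<close>

lemma edge_dist_le_of_dominating:
  assumes u: "{v1, u} \<in> edges G"
    and dom: "\<And>w. {v1, w} \<in> edges G \<Longrightarrow> {v2, w} \<notin> edges G \<Longrightarrow> {u, w} \<in> edges G"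
    and s: "s \<noteq> v1"
  shows "edge_dist G {v2, u} s \<le> edge_dist G {v1, u} s"
proof -
  have "min (vertex_dist G v2 s) (vertex_dist G u s) \<le> vertex_dist G v1 s"
  proof (cases "vertex_dist G v1 s < \<infinity>")
    case True
    then obtain w where w: "{v1, w} \<in> edges G" "vertex_dist G v1 s = 1 + vertex_dist G w s"
      using vertex_dist_first_step s by metis
    show ?thesis
      using dom[OF w(1)] vertex_dist_step[of v2 w s] vertex_dist_step[of u w s] w(2)
      by (auto simp: min_le_iff_disj)
  qed simp
  then show ?thesis
    by (simp add: edge_dist_pair)
qed

text \<open>The edge \<open>{v1, u}\<close> is within distance 1 of \<open>w\<close> through
  \<open>v1\<close>, hence so is \<open>{v2, u}\<close>. Since \<open>v2\<close> is too far from
  \<open>w\<close>, its other end \<open>u\<close> must be adjacent to \<open>w\<close>.\<close>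

lemma adjacent_of_edge_dist_eq:
  assumes eq: "edge_dist G {v1, u} w = edge_dist G {v2, u} w"
    and w: "{v1, w} \<in> edges G" "{v2, w} \<notin> edges G" "w \<noteq> v2" "w \<noteq> u"
  shows "{u, w} \<in> edges G"
proof -
  have "edge_dist G {v2, u} w \<le> 1"
    using w(1) vertex_dist_le_one_iff[of v1 w] edge_distinct[of v1 w]
    unfolding eq[symmetric] by (simp add: edge_dist_pair min_le_iff_disj)
  then show ?thesis
    using w vertex_dist_le_one_iff[of v2 w] vertex_dist_le_one_iff[of u w]
    by (auto simp: edge_dist_pair min_le_iff_disj)
qed

lemma not_generator_remove2_iff:
  assumes v: "v1 \<in> verts G" "v2 \<in> verts G" "v1 \<noteq> v2"
  shows "\<not> edge_metric_generator G (verts G - {v1, v2}) \<longleftrightarrow>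
    (\<exists>u \<in> verts G. {v1, u} \<in> edges G \<and> {v2, u} \<in> edges G \<and>
        (\<forall>w \<in> non_mutual_neighbors G v1 v2. w \<in> neighbors G u))"
    (is "?L \<longleftrightarrow> ?R")
proof
  assume ?L
  then obtain e1 e2 where e: "e1 \<in> edges G" "e2 \<in> edges G" "e1 \<noteq> e2"
    and eq: "\<And>s. s \<in> verts G - {v1, v2} \<Longrightarrow> edge_dist G e1 s = edge_dist G e2 s"
    unfolding edge_metric_generator_def by blast
  have sub: "e1 \<subseteq> verts G" "e2 \<subseteq> verts G"
    using e edge_subset_verts by blast+
  \<comment> \<open>Equal distances are in particular zero together, so the edges agree outside
    \<open>v1\<close> and \<open>v2\<close>.\<close>
  have out: "s \<in> e1 \<longleftrightarrow> s \<in> e2" if "s \<in> verts G - {v1, v2}" for s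
    using eq[OF that] that edge_dist_eq_0_iff[OF e(1), of s] edge_dist_eq_0_iff[OF e(2), of s]
    by simp
  have "\<not> e1 \<subseteq> e2" "\<not> e2 \<subseteq> e1"
    using e edges_eqI[of e1 e2] edges_eqI[of e2 e1] by auto
  then have "v1 \<in> e1 \<and> v1 \<notin> e2 \<and> v2 \<in> e2 \<and> v2 \<notin> e1 \<or> v2 \<in> e1 \<and> v2 \<notin> e2 \<and> v1 \<in> e2 \<and> v1 \<notin> e1"
    using out sub by blast
  \<comment> \<open>The two cases differ only by exchanging the edges, so the argument is given for
    \<open>f1\<close> containing \<open>v1\<close> and \<open>f2\<close> containing
    \<open>v2\<close>, and applied in both orders.\<close>
  moreover have "?R"
    if f: "f1 \<in> edges G" "f2 \<in> edges G" "v1 \<in> f1" "v1 \<notin> f2" "v2 \<in> f2" "v2 \<notin> f1"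
      and feq: "\<And>s. s \<in> verts G - {v1, v2} \<Longrightarrow> edge_dist G f1 s = edge_dist G f2 s"
      and fout: "\<And>s. s \<in> verts G - {v1, v2} \<Longrightarrow> s \<in> f1 \<longleftrightarrow> s \<in> f2"
    for f1 f2
  proof -
    obtain u where u: "f1 = {v1, u}" "u \<noteq> v1" "u \<in> verts G"
      using f(1,3) by (rule edge_incidentE)
    have "u \<noteq> v2" "u \<in> f2"
      using fout[of u] u f by auto
    obtain u' where "f2 = {v2, u'}"
      using f(2,5) by (rule edge_incidentE)
    then have f2: "f2 = {v2, u}"
      using \<open>u \<in> f2\<close> \<open>u \<noteq> v2\<close> by simp
    have "w \<in> neighbors G u" if w: "w \<in> non_mutual_neighbors G v1 v2" for w
    proof -
      have wV: "w \<in> verts G"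
        and cases: "{v1, w} \<in> edges G \<and> {v2, w} \<notin> edges G \<or> {v2, w} \<in> edges G \<and> {v1, w} \<notin> edges G"
        using w by (auto simp: non_mutual_neighbors_def neighbors_def)
      have "w \<noteq> u"
        using cases f u f2 by auto
      have "{u, w} \<in> edges G"
      \<comment> \<open>If \<open>v1\<close> and \<open>v2\<close> are adjacent, they are themselves
        non-mutual neighbors. Equality of distances is not assumed there, but then
        \<open>{u, w}\<close> is \<open>f1\<close> or \<open>f2\<close>.\<close>
      proof (cases "w \<in> {v1, v2}")
        case True
        then show ?thesis
          using f u f2 by (auto simp: insert_commute)
      next
        case False
        then have "edge_dist G {v1, u} w = edge_dist G {v2, u} w"
          using feq[of w] wV u f2 by auto
        then show ?thesis
          using cases False \<open>w \<noteq> u\<close> adjacent_of_edge_dist_eq[of v1 u w v2]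
            adjacent_of_edge_dist_eq[of v2 u w v1] by auto
      qed
      then show ?thesis
        using wV by (simp add: neighbors_def)
    qed
    then show ?thesis
      using u f f2 by blast
  qed
  ultimately show ?R
    using e eq out by metis
next
  assume ?R
  then obtain u where u: "{v1, u} \<in> edges G" "{v2, u} \<in> edges G"
    and dom: "\<And>w. w \<in> non_mutual_neighbors G v1 v2 \<Longrightarrow> {u, w} \<in> edges G"
    by (auto simp: neighbors_def)
  \<comment> \<open>A neighbor of exactly one of \<open>v1\<close> and \<open>v2\<close> is
    non-mutual, so \<open>u\<close> dominates in both directions.\<close>
  have "edge_dist G {v1, u} s = edge_dist G {v2, u} s" if "s \<in> verts G - {v1, v2}" for s
  proof (rule antisym)
    show "edge_dist G {v1, u} s \<le> edge_dist G {v2, u} s"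
      using that u dom edge_in_verts
      by (intro edge_dist_le_of_dominating) (auto simp: non_mutual_neighbors_def neighbors_def)
    show "edge_dist G {v2, u} s \<le> edge_dist G {v1, u} s"
      using that u dom edge_in_verts
      by (intro edge_dist_le_of_dominating) (auto simp: non_mutual_neighbors_def neighbors_def)
  qed
  moreover have "{v1, u} \<noteq> {v2, u}"
    using v(3) by (auto simp: doubleton_eq_iff)
  ultimately show ?L
    using u unfolding edge_metric_generator_def by meson
qed

section \<open>From omitted pairs to the edge metric dimension\<close>

lemma edim_eq_iff:
  assumes "verts G \<noteq> {}"
  shows "edim G = card (verts G) - 1 \<longleftrightarrow>
    (\<forall>v1 \<in> verts G. \<forall>v2 \<in> verts G. v1 \<noteq> v2 \<longrightarrow>
      \<not> edge_metric_generator G (verts G - {v1, v2}))" (is "?L \<longleftrightarrow> ?R")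
proof
  assume ?L
  show ?R
  proof (intro ballI impI notI)
    fix v1 v2 assume v: "v1 \<in> verts G" "v2 \<in> verts G" "v1 \<noteq> v2"
      and gen: "edge_metric_generator G (verts G - {v1, v2})"
    have "edim G \<le> card (verts G - {v1, v2})"
      unfolding edim_def using gen by (intro Least_le) blast
    moreover have "card (verts G - {v1, v2}) = card (verts G) - 2"
      using v by (simp add: card_Diff_subset)
    \<comment> \<open>Subtraction on \<open>nat\<close> is truncated; this bound makes
      \<open>card (verts G) - 2\<close> strictly smaller than
      \<open>card (verts G) - 1\<close>.\<close>
    moreover have "card (verts G) \<ge> 2"
      using v card_mono[of "verts G" "{v1, v2}"] by simp
    ultimately show False
      using \<open>?L\<close> by simp
  qed
next
  assume R: ?R
  obtain v where v: "v \<in> verts G"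
    using assms by blast
  show ?L
    unfolding edim_def
  proof (rule Least_equality)
    show "\<exists>S. edge_metric_generator G S \<and> card S = card (verts G) - 1"
      using edge_metric_generator_remove1[OF v] v by force
  next
    fix k assume "\<exists>S. edge_metric_generator G S \<and> card S = k"
    then obtain S where S: "edge_metric_generator G S" "card S = k"
      by blast
    then have sub: "S \<subseteq> verts G"
      by (simp add: edge_metric_generator_def)
    show "card (verts G) - 1 \<le> k"
    proof (rule ccontr)
      assume "\<not> card (verts G) - 1 \<le> k"
      \<comment> \<open>A smaller generator misses two vertices; enlarging it to the complement of
        such a pair contradicts \<open>R\<close>.\<close>
      then have "2 \<le> card (verts G - S)"
        using S(2) sub by (simp add: card_Diff_subset finite_subset)
      then obtain T where "T \<subseteq> verts G - S" "card T = 2"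
        by (meson obtain_subset_with_card_n)
      then obtain v1 v2 where "v1 \<in> verts G - S" "v2 \<in> verts G - S" "v1 \<noteq> v2"
        by (auto simp: card_2_iff)
      then show False
        using R edge_metric_generator_mono[OF S(1), of "verts G - {v1, v2}"] sub by blast
    qed
  qed
qed

end

theorem theorem2p2:
  fixes G :: "('a, 'b) pre_digraph" and n :: nat
  assumes "graph G"
    and "Digraph_Component.connected G"
    and "card (verts G) = n"
  shows "edim G = n - 1 \<longleftrightarrow>
    (\<forall>v1 \<in> verts G. \<forall>v2 \<in> verts G. v1 \<noteq> v2 \<longrightarrow>
      (\<exists>u \<in> verts G. {v1, u} \<in> edges G \<and> {v2, u} \<in> edges G \<and>
        (\<forall>w \<in> non_mutual_neighbors G v1 v2. w \<in> neighbors G u)))"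
proof -
  interpret graph G by fact
  \<comment> \<open>Connectedness in the library includes nonemptiness.\<close>
  have "verts G \<noteq> {}"
    using assms(2) by (simp add: connected_conv)
  from edim_eq_iff[OF this] show ?thesis
    unfolding assms(3) using not_generator_remove2_iff by simp
qed

end
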